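(* For every prime power $q$ there exists a number $c_q\in(0,q)$ such that the following holds for every positive integer $n$: if a set $A\subseteq(\mathbb{F}_q^n)^2$ does not contain three distinct points of the form $(a,b),\ (a+u,b+v),\ (a-v,b+u)$ with $a,b,u,v\in\mathbb{F}_q^n$, then $|A|\leq 3c_q^{2n}$.
   Context: $\mathbb{F}_q$ denotes the finite field with $q$ elements. The paper names the translation vectors $m,n$; here they are renamed $u,v$ to avoid a clash with the dimension $n$. *)

theory Defs
  imports "Jordan_Normal_Form.Matrix" "HOL-Number_Theory.Prime_Powers"
begin

end

theory Submission
  imports Defs "Berlekamp_Zassenhaus.Berlekamp_Type_Based"
begin

text \<open>Three points \<open>(a\<^sub>i, b\<^sub>i)\<close> form a (possibly degenerate) triangle iff
  \<open>a\<^sub>3 + b\<^sub>2 = a\<^sub>1 + b\<^sub>1\<close> and \<open>(a\<^sub>3 + b\<^sub>3) + (b\<^sub>2 - a\<^sub>2) = 2 b\<^sub>1\<close>. On a triangle-free set both hold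
  only if the second and third points agree, and they determine the first one up to its projection
  \<open>(a\<^sub>1 + b\<^sub>1, 2 b\<^sub>1)\<close>. Expanding the indicator of the first equation into monomials, each of
  degree at most a third in one of its three vectors, and splitting the second one according to the
  value of its part in that vector writes this tensor with few slices. A function on the
  projections that annihilates the slices in the first point, and equals 1 outside a small set,
  contracts the tensor to an almost full-rank diagonal matrix, which bounds the set. The factors
  \<open>|fibre|\<close> and \<open>|range of 2 b\<^sub>1|\<close> multiply to \<open>q\<^sup>n\<close>, whatever the characteristic.\<close>

section \<open>Linear algebra: annihilators and the slice rank of a diagonal tensor\<close>

text \<open>Gaussian elimination: each linear condition costs at most one pivot, and
  \<open>h\<close> can be kept equal to 1 at every point that is not a pivot.\<close>

lemma exists_annihilator:
  fixes f :: "'i \<Rightarrow> 'x \<Rightarrow> 'k::field"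
  assumes "finite I" "finite R"
  shows "\<exists>S h. S \<subseteq> R \<and> card S \<le> card I \<and> (\<forall>x\<in>R - S. h x = 1) \<and>
    (\<forall>i\<in>I. (\<Sum>x\<in>R. h x * f i x) = 0)"
  using assms
proof (induction I arbitrary: f R rule: finite_induct)
  case empty
  show ?case by (rule exI[of _ "{}"], rule exI[of _ "\<lambda>_. 1"]) simp
next
  case (insert i I)
  show ?case
  proof (cases "\<forall>x\<in>R. f i x = 0")
    case True
    obtain S h where "S \<subseteq> R" "card S \<le> card I" "\<forall>x\<in>R - S. h x = 1"
      "\<forall>i\<in>I. (\<Sum>x\<in>R. h x * f i x) = 0"
      using insert.IH[OF insert.prems, of f] by blast
    moreover have "(\<Sum>x\<in>R. h x * f i x) = 0" using True by simp
    ultimately show ?thesis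
      using insert.hyps by (intro exI[of _ S] exI[of _ h]) (auto simp: card_insert_if)
  next
    case False
    then obtain r where r: "r \<in> R" "f i r \<noteq> 0" by blast
    \<comment> \<open>Each \<open>f' j\<close> vanishes at the pivot \<open>r\<close>, so the
      induction hypothesis on \<open>R - {r}\<close> leaves the value at \<open>r\<close> free;
      \<open>h'\<close> spends it on condition \<open>i\<close>.\<close>
    define f' where "f' = (\<lambda>j x. f j x - f j r / f i r * f i x)"
    obtain S h where S: "S \<subseteq> R - {r}" "card S \<le> card I" "\<forall>x\<in>R - {r} - S. h x = 1"
      and h: "\<forall>j\<in>I. (\<Sum>x\<in>R - {r}. h x * f' j x) = 0"
      using insert.IH[of "R - {r}" f'] insert.prems by auto
    define h' where "h' = h(r := - (\<Sum>x\<in>R - {r}. h x * f i x) / f i r)"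
    have split: "(\<Sum>x\<in>R. h' x * f j x) = h' r * f j r + (\<Sum>x\<in>R - {r}. h x * f j x)" for j
    proof -
      have "(\<Sum>x\<in>R. h' x * f j x) = h' r * f j r + (\<Sum>x\<in>R - {r}. h' x * f j x)"
        using insert.prems r by (simp add: sum.remove)
      also have "(\<Sum>x\<in>R - {r}. h' x * f j x) = (\<Sum>x\<in>R - {r}. h x * f j x)"
        by (rule sum.cong) (auto simp: h'_def)
      finally show ?thesis .
    qed
    have "(\<Sum>x\<in>R. h' x * f i x) = 0"
      unfolding split using r by (simp add: h'_def)
    moreover have "(\<Sum>x\<in>R. h' x * f j x) = 0" if "j \<in> I" for j
    proof -
      have "0 = (\<Sum>x\<in>R - {r}. h x * f' j x)" using h that by simp
      also have "\<dots> = (\<Sum>x\<in>R - {r}. h x * f j x - f j r / f i r * (h x * f i x))"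
        by (rule sum.cong) (simp_all add: f'_def right_diff_distrib mult_ac)
      also have "\<dots> = (\<Sum>x\<in>R - {r}. h x * f j x) - f j r / f i r * (\<Sum>x\<in>R - {r}. h x * f i x)"
        by (simp only: sum_subtractf sum_distrib_left)
      finally show ?thesis
        unfolding split by (simp add: h'_def field_simps)
    qed
    moreover have "card (insert r S) \<le> card (insert i I)"
      using S insert.hyps insert.prems finite_subset[OF S(1)] by (auto simp: card_insert_if)
    moreover have "\<forall>x\<in>R - insert r S. h' x = 1"
      using S by (auto simp: h'_def)
    ultimately show ?thesis
      using S r by (intro exI[of _ "insert r S"] exI[of _ h']) auto
  qed
qed

text \<open>The hypothesis factors the identity on functions over \<open>A\<close> through functions
  over \<open>J\<close>. Over a finite field the dimension comparison becomes counting: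
  \<open>\<phi>\<close> is injective between finite function spaces.\<close>

lemma identity_matrix_rank:
  fixes u :: "'j \<Rightarrow> 'p \<Rightarrow> 'k::{field,finite}"
  assumes fin: "finite J" "finite A"
    and eq: "\<And>P Q. P \<in> A \<Longrightarrow> Q \<in> A \<Longrightarrow> (\<Sum>j\<in>J. u j P * w j Q) = of_bool (P = Q)"
  shows "card A \<le> card J"
proof -
  define \<phi> where "\<phi> c = (\<lambda>j\<in>J. \<Sum>P\<in>A. c P * u j P)" for c :: "'p \<Rightarrow> 'k"
  have recover: "(\<Sum>j\<in>J. \<phi> c j * w j Q) = c Q" if "Q \<in> A" for c Q
  proof -
    have "(\<Sum>j\<in>J. \<phi> c j * w j Q) = (\<Sum>j\<in>J. \<Sum>P\<in>A. c P * (u j P * w j Q))"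
      by (simp add: \<phi>_def sum_distrib_right mult.assoc)
    also have "\<dots> = (\<Sum>P\<in>A. c P * (\<Sum>j\<in>J. u j P * w j Q))"
      by (subst sum.swap) (simp add: sum_distrib_left)
    also have "\<dots> = (\<Sum>P\<in>A. if P = Q then c P else 0)"
      using eq that by (intro sum.cong) auto
    finally show ?thesis using that fin by simp
  qed
  have "inj_on \<phi> (A \<rightarrow>\<^sub>E UNIV)"
  proof (rule inj_onI)
    fix c d assume cd: "c \<in> A \<rightarrow>\<^sub>E UNIV" "d \<in> A \<rightarrow>\<^sub>E UNIV" "\<phi> c = \<phi> d"
    show "c = d"
    proof (rule PiE_ext[OF cd(1,2)])
      fix Q assume "Q \<in> A"
      then show "c Q = d Q" using recover[of Q c] recover[of Q d] cd(3) by simp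
    qed
  qed
  moreover have "\<phi> ` (A \<rightarrow>\<^sub>E UNIV) \<subseteq> J \<rightarrow>\<^sub>E UNIV"
    by (auto simp: \<phi>_def)
  ultimately have "card (A \<rightarrow>\<^sub>E (UNIV :: 'k set)) \<le> card (J \<rightarrow>\<^sub>E (UNIV :: 'k set))"
    by (rule card_inj_on_le) (simp add: fin finite_PiE)
  then have "CARD('k) ^ card A \<le> CARD('k) ^ card J"
    by (simp add: card_PiE fin)
  \<comment> \<open>The base of the two powers must exceed 1 for the exponents to be
    comparable.\<close>
  moreover have "card {0, 1 :: 'k} \<le> CARD('k)"
    by (rule card_mono) auto
  ultimately show ?thesis by simp
qed

text \<open>Summing the tensor against an annihilator \<open>h\<close> of the \<open>f1 i\<close>
  removes the first family. On points projecting outside the exceptional set \<open>S\<close> an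
  identity matrix remains, written with \<open>card J + card L\<close> rank-one terms. The discarded
  points lie in at most \<open>card I\<close> fibres, which is where the factor \<open>F\<close>
  enters.\<close>

lemma slice_rank_bound:
  fixes f1 :: "'i \<Rightarrow> 'x \<Rightarrow> 'k::{field,finite}"
    and f2 :: "'j \<Rightarrow> 'p \<Rightarrow> 'k" and f3 :: "'l \<Rightarrow> 'p \<Rightarrow> 'k"
  assumes fin: "finite A" "finite I" "finite J" "finite L"
    and fibre: "\<And>x. card {P \<in> A. \<pi> P = x} \<le> F"
    and slices: "\<And>x P Q. x \<in> \<pi> ` A \<Longrightarrow> P \<in> A \<Longrightarrow> Q \<in> A \<Longrightarrow>
      of_bool (P = Q \<and> x = \<pi> P) =
        (\<Sum>i\<in>I. f1 i x * g1 i P Q) + (\<Sum>j\<in>J. f2 j P * g2 j x Q) + (\<Sum>l\<in>L. f3 l Q * g3 l x P)"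
  shows "card A \<le> F * card I + card J + card L"
proof -
  define R where "R = \<pi> ` A"
  have finR: "finite R" using fin by (simp add: R_def)
  obtain S h where S: "S \<subseteq> R" "card S \<le> card I" "\<forall>x\<in>R - S. h x = 1"
    and h: "\<forall>i\<in>I. (\<Sum>x\<in>R. h x * f1 i x) = 0"
    using exists_annihilator[OF fin(2) finR, of f1] by blast
  have finS: "finite S" using finR S(1) by (rule finite_subset[rotated])
  define B where "B = {P \<in> A. \<pi> P \<notin> S}"
  have "card {P \<in> A. \<pi> P \<in> S} \<le> F * card I"
  proof -
    have "{P \<in> A. \<pi> P \<in> S} = (\<Union>x\<in>S. {P \<in> A. \<pi> P = x})" by auto
    then have "card {P \<in> A. \<pi> P \<in> S} \<le> (\<Sum>x\<in>S. card {P \<in> A. \<pi> P = x})"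
      using card_UN_le[OF finS] by simp
    also have "\<dots> \<le> (\<Sum>x\<in>S. F)" by (intro sum_mono fibre)
    also have "\<dots> \<le> F * card I" using S(2) by (simp add: mult.commute)
    finally show ?thesis .
  qed
  moreover have "card B \<le> card (J <+> L)"
  proof (rule identity_matrix_rank)
    show "finite (J <+> L)" "finite B" using fin by (auto simp: B_def)
    fix P Q assume P: "P \<in> B" and Q: "Q \<in> B"
    let ?u = "case_sum f2 (\<lambda>l P. \<Sum>x\<in>R. h x * g3 l x P)"
    let ?w = "case_sum (\<lambda>j Q. \<Sum>x\<in>R. h x * g2 j x Q) f3"
    have PA: "P \<in> A" "Q \<in> A" "\<pi> P \<in> R - S" using P Q by (auto simp: B_def R_def)
    \<comment> \<open>Since \<open>\<pi> P\<close> avoids \<open>S\<close>, the weight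
      \<open>h\<close> is 1 there; the sum over \<open>x\<close> then picks out exactly this
      diagonal entry.\<close>
    have "of_bool (P = Q) = h (\<pi> P) * of_bool (P = Q)" using S(3) PA by simp
    also have "\<dots> = (\<Sum>x\<in>R. if x = \<pi> P then h x * of_bool (P = Q) else 0)"
      using finR PA by simp
    also have "\<dots> = (\<Sum>x\<in>R. h x * of_bool (P = Q \<and> x = \<pi> P))"
      by (rule sum.cong) auto
    also have "\<dots> = (\<Sum>x\<in>R. h x * ((\<Sum>i\<in>I. f1 i x * g1 i P Q) + (\<Sum>j\<in>J. f2 j P * g2 j x Q) + (\<Sum>l\<in>L. f3 l Q * g3 l x P)))"
      using PA by (intro sum.cong refl arg_cong2[of _ _ _ _ "(*)"] slices) (auto simp: R_def)
    also have "\<dots> = (\<Sum>x\<in>R. h x * (\<Sum>i\<in>I. f1 i x * g1 i P Q))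
        + (\<Sum>x\<in>R. h x * (\<Sum>j\<in>J. f2 j P * g2 j x Q)) + (\<Sum>x\<in>R. h x * (\<Sum>l\<in>L. f3 l Q * g3 l x P))"
      by (simp add: distrib_left sum.distrib)
    also have "(\<Sum>x\<in>R. h x * (\<Sum>i\<in>I. f1 i x * g1 i P Q)) = (\<Sum>i\<in>I. (\<Sum>x\<in>R. h x * f1 i x) * g1 i P Q)"
      unfolding sum_distrib_left sum_distrib_right by (subst sum.swap) (simp add: mult.assoc)
    also have "\<dots> = 0" using h by simp
    also have "(\<Sum>x\<in>R. h x * (\<Sum>j\<in>J. f2 j P * g2 j x Q)) = (\<Sum>j\<in>J. f2 j P * (\<Sum>x\<in>R. h x * g2 j x Q))"
      unfolding sum_distrib_left by (subst sum.swap) (simp add: mult_ac)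
    also have "(\<Sum>x\<in>R. h x * (\<Sum>l\<in>L. f3 l Q * g3 l x P)) = (\<Sum>l\<in>L. (\<Sum>x\<in>R. h x * g3 l x P) * f3 l Q)"
      unfolding sum_distrib_left sum_distrib_right by (subst sum.swap) (simp add: mult_ac)
    finally show "(\<Sum>j\<in>J <+> L. ?u j P * ?w j Q) = of_bool (P = Q)"
      using fin by (simp add: sum.Plus)
  qed
  moreover have "card A = card {P \<in> A. \<pi> P \<in> S} + card B"
    unfolding B_def using fin(1) by (subst card_Un_disjoint[symmetric]) (auto intro: arg_cong[of _ _ card])
  ultimately show ?thesis using fin by (simp add: card_Plus)
qed

section \<open>Polynomial expansion of the zero test over a finite field\<close>

lemma trinomial_expansion:
  fixes m :: nat
  obtains D and C :: "nat \<times> nat \<times> nat \<Rightarrow> 'k::comm_ring_1" where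
    "finite D" "\<And>i j l. (i, j, l) \<in> D \<Longrightarrow> i + j + l = m"
    "\<And>x y z :: 'k. (x + y + z) ^ m = (\<Sum>(i, j, l)\<in>D. C (i, j, l) * x ^ i * y ^ j * z ^ l)"
proof -
  define K where "K = (SIGMA i:{..m}. {..m - i})"
  define \<psi> where "\<psi> = (\<lambda>(i, j). (i, j, m - i - j))"
  define C :: "nat \<times> nat \<times> nat \<Rightarrow> 'k" where
    "C = (\<lambda>(i, j, l). of_nat (m choose i) * of_nat ((m - i) choose j))"
  have inj: "inj_on \<psi> K" by (auto simp: inj_on_def \<psi>_def)
  have "(x + y + z) ^ m = (\<Sum>(i, j, l)\<in>\<psi> ` K. C (i, j, l) * x ^ i * y ^ j * z ^ l)" for x y z :: 'k
  proof -
    have "(x + y + z) ^ m = (\<Sum>i\<le>m. of_nat (m choose i) * x ^ i * (y + z) ^ (m - i))"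
      by (simp add: add.assoc binomial_ring)
    also have "\<dots> = (\<Sum>i\<le>m. \<Sum>j\<le>m - i. C (\<psi> (i, j)) * x ^ i * y ^ j * z ^ (m - i - j))"
      by (simp add: binomial_ring[of y z] sum_distrib_left C_def \<psi>_def mult_ac)
    also have "\<dots> = (\<Sum>(i, j)\<in>K. C (\<psi> (i, j)) * x ^ i * y ^ j * z ^ (m - i - j))"
      unfolding K_def by (subst sum.Sigma) auto
    also have "\<dots> = (\<Sum>(i, j, l)\<in>\<psi> ` K. C (i, j, l) * x ^ i * y ^ j * z ^ l)"
      unfolding sum.reindex[OF inj] by (rule sum.cong) (auto simp: \<psi>_def)
    finally show ?thesis .
  qed
  moreover have "finite (\<psi> ` K)" by (simp add: K_def)
  moreover have "i + j + l = m" if "(i, j, l) \<in> \<psi> ` K" for i j l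
    using that by (auto simp: K_def \<psi>_def)
  ultimately show thesis by (intro that[of "\<psi> ` K" C])
qed

text \<open>Multiplication by \<open>t\<close> permutes the nonzero elements, so their nonzero
  product absorbs the factor \<open>t ^ (CARD('k) - 1)\<close>.\<close>

lemma finite_field_fermat:
  fixes t :: "'k::{field,finite}"
  assumes "t \<noteq> 0"
  shows "t ^ (CARD('k) - 1) = 1"
proof -
  have "bij_betw ((*) t) (UNIV - {0}) (UNIV - {0})"
    by (rule bij_betw_byWitness[where f' = "\<lambda>c. c / t"]) (use assms in auto)
  then have "(\<Prod>c\<in>UNIV - {0}. c) = (\<Prod>c\<in>UNIV - {0}. t * c)"
    by (rule prod.reindex_bij_betw[symmetric])
  also have "\<dots> = t ^ (CARD('k) - 1) * (\<Prod>c\<in>UNIV - {0}. c)"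
    by (simp add: prod.distrib card_Diff_singleton)
  finally show ?thesis by (auto simp: prod_zero_iff)
qed

text \<open>By Fermat the indicator of \<open>t = 0\<close> is
  \<open>1 - t ^ (CARD('k) - 1)\<close>; the trinomial expansion is applied to
  \<open>t = x + y + z\<close>.\<close>

lemma zero_test_expansion:
  obtains D and C :: "nat \<times> nat \<times> nat \<Rightarrow> 'k::{field,finite}" where
    "finite D" "\<And>i j l. (i, j, l) \<in> D \<Longrightarrow> i + j + l \<le> CARD('k) - 1"
    "\<And>x y z :: 'k. of_bool (x + y + z = 0) = (\<Sum>(i, j, l)\<in>D. C (i, j, l) * x ^ i * y ^ j * z ^ l)"
proof -
  have "card {0, 1 :: 'k} \<le> CARD('k)" by (rule card_mono) auto
  then have m: "CARD('k) - 1 > 0" by simp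
  obtain D and C :: "nat \<times> nat \<times> nat \<Rightarrow> 'k" where D: "finite D"
    "\<And>i j l. (i, j, l) \<in> D \<Longrightarrow> i + j + l = CARD('k) - 1"
    and C: "\<And>x y z :: 'k. (x + y + z) ^ (CARD('k) - 1) = (\<Sum>(i, j, l)\<in>D. C (i, j, l) * x ^ i * y ^ j * z ^ l)"
    by (rule trinomial_expansion[where m = "CARD('k) - 1" and ?'k = 'k]) (rule that)
  have D0: "(0, 0, 0) \<notin> D" using D(2)[of 0 0 0] m by auto
  \<comment> \<open>The constant 1 occupies the exponent \<open>(0, 0, 0)\<close>, which is absent
    from \<open>D\<close> because exponents there have positive sum; all other coefficients change
    sign.\<close>
  define C' where "C' = (\<lambda>e. - C e)((0, 0, 0) := 1)"
  have fermat: "of_bool (t = 0) = 1 - t ^ (CARD('k) - 1)" for t :: 'k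
  proof (cases "t = 0")
    case False
    then show ?thesis using finite_field_fermat[of t] by simp
  qed (use m in simp)
  show thesis
  proof (rule that[of "insert (0, 0, 0) D" C'])
    show "finite (insert (0, 0, 0) D)" using D by simp
    show "i + j + l \<le> CARD('k) - 1" if "(i, j, l) \<in> insert (0, 0, 0) D" for i j l
      using that D(2)[of i j l] by auto
    fix x y z :: 'k
    have "(\<Sum>(i, j, l)\<in>D. C' (i, j, l) * x ^ i * y ^ j * z ^ l)
        = (\<Sum>(i, j, l)\<in>D. - (C (i, j, l) * x ^ i * y ^ j * z ^ l))"
      using D0 by (intro sum.cong) (auto simp: C'_def)
    also have "\<dots> = - ((x + y + z) ^ (CARD('k) - 1))"
      unfolding C by (simp add: sum_negf case_prod_beta)
    finally show "of_bool (x + y + z = 0)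
        = (\<Sum>(i, j, l)\<in>insert (0, 0, 0) D. C' (i, j, l) * x ^ i * y ^ j * z ^ l)"
      using D D0 by (simp add: fermat C'_def)
  qed
qed

section \<open>Slices with a low-degree monomial, and their number\<close>

text \<open>The bound is one third of the largest total degree \<open>n * m\<close>, stated without
  division. Extensional functions make the set finite and each exponent vector unique.\<close>

definition low_exponents :: "nat \<Rightarrow> nat \<Rightarrow> (nat \<Rightarrow> nat) set" where
  "low_exponents m n = {i \<in> {..<n} \<rightarrow>\<^sub>E {..m}. 3 * (\<Sum>t<n. i t) \<le> n * m}"

definition monom_fun :: "nat \<Rightarrow> (nat \<Rightarrow> nat) \<Rightarrow> (nat \<Rightarrow> 'k::comm_monoid_mult) \<Rightarrow> 'k" where
  "monom_fun n i x = (\<Prod>t<n. x t ^ i t)"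

lemma finite_low_exponents: "finite (low_exponents m n)"
  unfolding low_exponents_def by (rule finite_subset[of _ "{..<n} \<rightarrow>\<^sub>E {..m}"]) (auto intro: finite_PiE)

text \<open>Collecting terms with a common factor makes the number of slices depend on the number of
  keys rather than of terms.\<close>

lemma sum_by_key:
  fixes u :: "'i \<Rightarrow> 'k::semiring_0"
  assumes "finite E" "finite I" "key ` E \<subseteq> I"
  shows "(\<Sum>e\<in>E. u (key e) * w e) = (\<Sum>i\<in>I. u i * (\<Sum>e\<in>{e \<in> E. key e = i}. w e))"
proof -
  have "(\<Sum>e\<in>E. u (key e) * w e) = (\<Sum>i\<in>I. \<Sum>e\<in>{e \<in> E. key e = i}. u (key e) * w e)"
    by (rule sum.group[OF assms, symmetric])
  then show ?thesis by (simp add: sum_distrib_left)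
qed

text \<open>The product of the coordinatewise zero tests expands into monomials of total degree at
  most \<open>n * m\<close>. By pigeonhole each has degree at most \<open>n * m / 3\<close> in one
  of \<open>x\<close>, \<open>y\<close>, \<open>z\<close>, and it is grouped by that factor.\<close>

lemma sum_zero_slices:
  fixes n :: nat
  defines "I \<equiv> low_exponents (CARD('k::{field,finite}) - 1) n"
  obtains G1 G2 G3 :: "(nat \<Rightarrow> nat) \<Rightarrow> (nat \<Rightarrow> 'k::{field,finite}) \<Rightarrow> (nat \<Rightarrow> 'k) \<Rightarrow> 'k" where
    "\<And>x y z. of_bool (\<forall>t<n. x t + y t + z t = 0) =
      (\<Sum>i\<in>I. monom_fun n i x * G1 i y z) + (\<Sum>i\<in>I. monom_fun n i y * G2 i x z)
      + (\<Sum>i\<in>I. monom_fun n i z * G3 i x y)"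
proof -
  define m where "m = CARD('k) - 1"
  obtain D and C :: "nat \<times> nat \<times> nat \<Rightarrow> 'k" where D: "finite D"
    "\<And>i j l. (i, j, l) \<in> D \<Longrightarrow> i + j + l \<le> m"
    and C: "\<And>x y z :: 'k. of_bool (x + y + z = 0) = (\<Sum>(i, j, l)\<in>D. C (i, j, l) * x ^ i * y ^ j * z ^ l)"
    by (rule zero_test_expansion[where ?'k = 'k, folded m_def]) (rule that)
  define E where "E = {..<n} \<rightarrow>\<^sub>E D"
  have finE: "finite E" unfolding E_def using D by (auto intro: finite_PiE)
  define p1 p2 p3 :: "nat \<times> nat \<times> nat \<Rightarrow> nat" where
    "p1 = fst" and "p2 = fst \<circ> snd" and "p3 = snd \<circ> snd"
  note p_defs = p1_def p2_def p3_def
  define key where "key p e = (\<lambda>t\<in>{..<n}. p (e t))" for p :: "nat \<times> nat \<times> nat \<Rightarrow> nat" and e :: "nat \<Rightarrow> nat \<times> nat \<times> nat"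
  define K where "K e = (\<Prod>t<n. C (e t))" for e :: "nat \<Rightarrow> nat \<times> nat \<times> nat"
  define low where "low p = {e \<in> E. 3 * (\<Sum>t<n. p (e t)) \<le> n * m}" for p :: "nat \<times> nat \<times> nat \<Rightarrow> nat"
  have bnd: "p1 d + p2 d + p3 d \<le> m" if "d \<in> D" for d
    using D(2)[of "p1 d" "p2 d" "p3 d"] that by (simp add: p_defs)
  have key_low: "key p ` E' \<subseteq> I" if "p \<in> {p1, p2, p3}" and low: "E' \<subseteq> low p" for p E'
  proof
    fix i assume "i \<in> key p ` E'"
    then obtain e where e: "e \<in> E" "3 * (\<Sum>t<n. p (e t)) \<le> n * m" "i = key p e"
      using low by (auto simp: low_def)
    have "p (e t) \<le> m" if "t < n" for t
      using e(1) that bnd[of "e t"] \<open>p \<in> {p1, p2, p3}\<close> by (auto simp: E_def PiE_iff)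
    then show "i \<in> I"
      using e unfolding I_def low_exponents_def m_def[symmetric] by (auto simp: key_def)
  qed
  have monom_key: "(\<Prod>t<n. x t ^ p (e t)) = monom_fun n (key p e) x" for x :: "nat \<Rightarrow> 'k" and p e
    unfolding monom_fun_def key_def by (rule prod.cong) auto
  \<comment> \<open>Each term goes to the first vector in which its degree is low, so that no term
    is counted twice.\<close>
  define E1 E2 E3 where "E1 = low p1" and "E2 = low p2 - low p1" and "E3 = E - low p1 - low p2"
  have E3: "E3 \<subseteq> low p3"
  proof
    fix e assume e: "e \<in> E3"
    then have "e \<in> E" by (simp add: E3_def)
    then have "(\<Sum>t<n. p1 (e t) + p2 (e t) + p3 (e t)) \<le> (\<Sum>t<n. m)"
      by (intro sum_mono bnd) (auto simp: E_def PiE_iff)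
    then have "(\<Sum>t<n. p1 (e t)) + (\<Sum>t<n. p2 (e t)) + (\<Sum>t<n. p3 (e t)) \<le> n * m"
      by (simp add: sum.distrib)
    then show "e \<in> low p3"
      using e by (auto simp: E3_def low_def)
  qed
  have sub: "E1 \<subseteq> low p1" "E2 \<subseteq> low p2" by (auto simp: E1_def E2_def)
  have fin: "finite E1" "finite E2" "finite E3" "finite I"
    using finE finite_low_exponents by (auto simp: E1_def E2_def E3_def low_def I_def)
  define G where "G E' p r s i x y = (\<Sum>e\<in>{e \<in> E'. key p e = i}. K e * monom_fun n (key r e) x * monom_fun n (key s e) y)"
    for E' p r s i and x y :: "nat \<Rightarrow> 'k"
  show thesis
  proof (rule that[of "G E1 p1 p2 p3" "G E2 p2 p1 p3" "G E3 p3 p1 p2"])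
    fix x y z :: "nat \<Rightarrow> 'k"
    define \<tau> where "\<tau> e = K e * monom_fun n (key p1 e) x * monom_fun n (key p2 e) y * monom_fun n (key p3 e) z" for e
    have "of_bool (\<forall>t<n. x t + y t + z t = 0) = (\<Prod>t<n. of_bool (x t + y t + z t = 0) :: 'k)"
      by (auto simp: of_bool_def prod_zero_iff)
    also have "\<dots> = (\<Prod>t<n. \<Sum>d\<in>D. C d * x t ^ p1 d * y t ^ p2 d * z t ^ p3 d)"
      unfolding C by (simp add: case_prod_beta p_defs)
    also have "\<dots> = (\<Sum>e\<in>E. \<tau> e)"
      unfolding E_def using D by (subst prod_sum_PiE) (auto simp: \<tau>_def prod.distrib K_def monom_key)
    also have "\<dots> = (\<Sum>e\<in>E1 \<union> (E2 \<union> E3). \<tau> e)"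
      by (rule sum.cong) (auto simp: E1_def E2_def E3_def low_def)
    also have "\<dots> = (\<Sum>e\<in>E1. \<tau> e) + ((\<Sum>e\<in>E2. \<tau> e) + (\<Sum>e\<in>E3. \<tau> e))"
      using fin by (subst sum.union_disjoint, auto simp: E1_def E2_def E3_def)+
    also have "(\<Sum>e\<in>E1. \<tau> e) = (\<Sum>e\<in>E1. monom_fun n (key p1 e) x * (K e * monom_fun n (key p2 e) y * monom_fun n (key p3 e) z))"
      by (simp add: \<tau>_def mult_ac)
    also have "\<dots> = (\<Sum>i\<in>I. monom_fun n i x * G E1 p1 p2 p3 i y z)"
      unfolding G_def using fin sub by (intro sum_by_key key_low) auto
    also have "(\<Sum>e\<in>E2. \<tau> e) = (\<Sum>e\<in>E2. monom_fun n (key p2 e) y * (K e * monom_fun n (key p1 e) x * monom_fun n (key p3 e) z))"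
      by (simp add: \<tau>_def mult_ac)
    also have "\<dots> = (\<Sum>i\<in>I. monom_fun n i y * G E2 p2 p1 p3 i x z)"
      unfolding G_def using fin sub by (intro sum_by_key key_low) auto
    also have "(\<Sum>e\<in>E3. \<tau> e) = (\<Sum>e\<in>E3. monom_fun n (key p3 e) z * (K e * monom_fun n (key p1 e) x * monom_fun n (key p2 e) y))"
      by (simp add: \<tau>_def mult_ac)
    also have "\<dots> = (\<Sum>i\<in>I. monom_fun n i z * G E3 p3 p1 p2 i x y)"
      unfolding G_def using fin E3 by (intro sum_by_key key_low) auto
    finally show "of_bool (\<forall>t<n. x t + y t + z t = 0) =
      (\<Sum>i\<in>I. monom_fun n i x * G E1 p1 p2 p3 i y z) + (\<Sum>i\<in>I. monom_fun n i y * G E2 p2 p1 p3 i x z)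
      + (\<Sum>i\<in>I. monom_fun n i z * G E3 p3 p1 p2 i x y)"
      by (simp add: add.assoc)
  qed
qed

text \<open>An exponential-moment (Chernoff) bound: as \<open>z \<le> 1\<close>, each low exponent
  vector has weight at least \<open>z ^ (n * m)\<close>, and the total weight over all exponent
  vectors factorises over the coordinates.\<close>

lemma card_low_exponents_le:
  fixes z :: real
  assumes "0 < z" "z \<le> 1"
  shows "card (low_exponents m n) \<le> ((\<Sum>i\<le>m. z ^ (3 * i)) / z ^ m) ^ n"
proof -
  have "card (low_exponents m n) * z ^ (n * m) = (\<Sum>i\<in>low_exponents m n. z ^ (n * m))" by simp
  also have "\<dots> \<le> (\<Sum>i\<in>low_exponents m n. z ^ (3 * (\<Sum>t<n. i t)))"
    using assms by (intro sum_mono power_decreasing) (auto simp: low_exponents_def)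
  also have "\<dots> \<le> (\<Sum>i\<in>{..<n} \<rightarrow>\<^sub>E {..m}. z ^ (3 * (\<Sum>t<n. i t)))"
    using assms by (intro sum_mono2 finite_PiE) (auto simp: low_exponents_def)
  also have "\<dots> = (\<Sum>i\<in>{..<n} \<rightarrow>\<^sub>E {..m}. \<Prod>t<n. z ^ (3 * i t))"
    by (simp add: sum_distrib_left power_sum)
  also have "\<dots> = (\<Sum>i\<le>m. z ^ (3 * i)) ^ n"
    by (subst prod_sum_PiE[symmetric]) auto
  finally show ?thesis
    using assms by (simp add: power_divide pos_le_divide_eq mult.commute flip: power_mult)
qed

text \<open>Equality holds at \<open>z = 1\<close>. There the derivative of \<open>\<Phi>\<close> is
  \<open>3m(m+1)/2 - m(m+1) = m(m+1)/2 > 0\<close>, so moving slightly to the left of 1 makes the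
  inequality strict.\<close>

lemma exists_growth_rate:
  assumes "m > 0"
  obtains z :: real where "0 < z" "z < 1" "(\<Sum>i\<le>m. z ^ (3 * i)) / z ^ m < Suc m"
proof -
  define \<Phi> where "\<Phi> z = (\<Sum>i\<le>m. z ^ (3 * i)) - Suc m * z ^ m" for z :: real
  have "(\<Phi> has_real_derivative ((\<Sum>i\<le>m. real (3 * i) * 1 ^ (3 * i - 1)) - Suc m * (real m * 1 ^ (m - 1)))) (at 1)"
    unfolding \<Phi>_def by (auto intro!: derivative_eq_intros simp: sum_distrib_left)
  moreover have "(\<Sum>i\<le>m. real (3 * i) * 1 ^ (3 * i - 1)) = 3 * (real m * (real m + 1) / 2)"
    by (induction m) (auto simp: field_simps)
  moreover have "3 * (real m * (real m + 1) / 2) - Suc m * (real m * 1 ^ (m - 1)) > 0"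
    using assms by (simp add: field_simps add_pos_pos)
  ultimately obtain l where "(\<Phi> has_real_derivative l) (at 1)" "l > 0" by metis
  then obtain d where d: "d > 0" "\<And>h. h > 0 \<Longrightarrow> h < d \<Longrightarrow> \<Phi> (1 - h) < \<Phi> 1"
    using DERIV_pos_inc_left by blast
  \<comment> \<open>Half of \<open>d\<close> stays strictly inside the interval, and the cap 1/2
    keeps \<open>1 - h\<close> positive.\<close>
  define h where "h = min (d / 2) (1 / 2)"
  have "\<Phi> (1 - h) < \<Phi> 1" using d by (intro d(2)) (auto simp: h_def min_def)
  also have "\<Phi> 1 = 0" by (simp add: \<Phi>_def)
  finally have "(\<Sum>i\<le>m. (1 - h) ^ (3 * i)) / (1 - h) ^ m < Suc m"
    using d by (subst pos_divide_less_eq) (auto simp: \<Phi>_def h_def min_def)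
  then show thesis using d by (intro that[of "1 - h"]) (auto simp: h_def min_def)
qed

text \<open>Splitting by the value \<open>w\<close> of \<open>e\<close> separates variables:
  \<open>e = w\<close> sees only the vector behind \<open>e\<close>, while \<open>T w\<close> sees
  only the others. The price is a factor \<open>card W\<close> in the number of slices.\<close>

lemma slice_product:
  assumes "finite I" "finite W" "e \<in> W"
  shows "(\<Sum>i\<in>I. f i * g i) * of_bool (T e) =
    (\<Sum>(w, i)\<in>W \<times> I. (f i * of_bool (e = w)) * (g i * of_bool (T w) :: 'k::comm_semiring_1))"
proof -
  have "(\<Sum>(w, i)\<in>W \<times> I. (f i * of_bool (e = w)) * (g i * of_bool (T w)))
      = (\<Sum>w\<in>W. \<Sum>i\<in>I. (f i * of_bool (e = w)) * (g i * of_bool (T w)))"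
    by (rule sum.cartesian_product[symmetric])
  also have "\<dots> = (\<Sum>w\<in>W. if w = e then \<Sum>i\<in>I. f i * (g i * of_bool (T w)) else 0)"
    by (rule sum.cong) auto
  also have "\<dots> = (\<Sum>i\<in>I. f i * g i) * of_bool (T e)"
    using assms by (simp add: sum_distrib_right mult.assoc)
  finally show ?thesis by simp
qed

section \<open>Triangles as solutions of two vector equations\<close>

lemma carrier_vec_eq_iff:
  "a \<in> carrier_vec n \<Longrightarrow> b \<in> carrier_vec n \<Longrightarrow> a = b \<longleftrightarrow> (\<forall>t<n. a $ t = b $ t)"
  by auto

text \<open>With \<open>u = a\<^sub>2 - a\<^sub>1\<close> and
  \<open>v = b\<^sub>2 - b\<^sub>1\<close>, the first equation says
  \<open>a\<^sub>3 = a\<^sub>1 - v\<close>; substituting it into the second cancels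
  \<open>b\<^sub>2\<close> and leaves \<open>b\<^sub>3 = b\<^sub>1 + u\<close>.\<close>

lemma triangle_equations:
  fixes a\<^sub>1 :: "'k::field vec"
  assumes carrier: "a\<^sub>1 \<in> carrier_vec n" "b\<^sub>1 \<in> carrier_vec n" "a\<^sub>2 \<in> carrier_vec n" "b\<^sub>2 \<in> carrier_vec n"
      "a\<^sub>3 \<in> carrier_vec n" "b\<^sub>3 \<in> carrier_vec n"
    and e1: "\<forall>t<n. - (a\<^sub>1 + b\<^sub>1) $ t + b\<^sub>2 $ t + a\<^sub>3 $ t = 0"
    and e2: "(a\<^sub>3 + b\<^sub>3) + (b\<^sub>2 - a\<^sub>2) = b\<^sub>1 + b\<^sub>1"
  shows "a\<^sub>2 = a\<^sub>1 + (a\<^sub>2 - a\<^sub>1)" "b\<^sub>2 = b\<^sub>1 + (b\<^sub>2 - b\<^sub>1)"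
    "a\<^sub>3 = a\<^sub>1 - (b\<^sub>2 - b\<^sub>1)" "b\<^sub>3 = b\<^sub>1 + (a\<^sub>2 - a\<^sub>1)"
proof -
  have e1': "a\<^sub>3 $ t = a\<^sub>1 $ t + b\<^sub>1 $ t - b\<^sub>2 $ t" if "t < n" for t
    using e1 that carrier by (auto simp: algebra_simps)
  have e2': "b\<^sub>3 $ t = b\<^sub>1 $ t + a\<^sub>2 $ t - a\<^sub>1 $ t" if "t < n" for t
  proof -
    have "(a\<^sub>3 $ t + b\<^sub>3 $ t) + (b\<^sub>2 $ t - a\<^sub>2 $ t) = ((a\<^sub>3 + b\<^sub>3) + (b\<^sub>2 - a\<^sub>2)) $ t"
      using that carrier by simp
    also have "\<dots> = (b\<^sub>1 + b\<^sub>1) $ t" unfolding e2 ..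
    also have "\<dots> = b\<^sub>1 $ t + b\<^sub>1 $ t" using that carrier by simp
    finally have "b\<^sub>3 $ t = b\<^sub>1 $ t + b\<^sub>1 $ t - (b\<^sub>2 $ t - a\<^sub>2 $ t) - a\<^sub>3 $ t"
      by (simp only: eq_diff_eq add.commute add.left_commute add.assoc)
    then show ?thesis using e1'[OF that] by (simp add: algebra_simps)
  qed
  show "a\<^sub>2 = a\<^sub>1 + (a\<^sub>2 - a\<^sub>1)" "b\<^sub>2 = b\<^sub>1 + (b\<^sub>2 - b\<^sub>1)"
    using carrier by auto
  show "a\<^sub>3 = a\<^sub>1 - (b\<^sub>2 - b\<^sub>1)" "b\<^sub>3 = b\<^sub>1 + (a\<^sub>2 - a\<^sub>1)"
    using carrier e1' e2' by (auto intro!: eq_vecI)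
qed

definition triangle_free :: "nat \<Rightarrow> ('k::field vec \<times> 'k vec) set \<Rightarrow> bool" where
  "triangle_free n A \<longleftrightarrow>
    \<not> (\<exists>a\<in>carrier_vec n. \<exists>b\<in>carrier_vec n. \<exists>u\<in>carrier_vec n. \<exists>v\<in>carrier_vec n.
        distinct [(a, b), (a + u, b + v), (a - v, b + u)] \<and>
        {(a, b), (a + u, b + v), (a - v, b + u)} \<subseteq> A)"

text \<open>In characteristic two a degenerate triangle only needs its last two vertices to coincide,
  so it determines the first vertex only up to this projection; in odd characteristic the
  projection is injective.\<close>

definition apex :: "'k::field vec \<times> 'k vec \<Rightarrow> 'k vec \<times> 'k vec" where
  "apex = (\<lambda>(a, b). (a + b, b + b))"

text \<open>This makes the tensor diagonal. A solution of the equations is a triangle in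
  \<open>A\<close>, hence degenerate. If the first vertex equals another one, then
  \<open>u = v = 0\<close>, so in every case the last two vertices agree, and the equations then
  give the apex.\<close>

lemma triangle_free_test:
  fixes A :: "('k::field vec \<times> 'k vec) set"
  assumes A: "A \<subseteq> carrier_vec n \<times> carrier_vec n" and free: "triangle_free n A"
    and x: "(s, d) \<in> apex ` A" and P: "(a\<^sub>2, b\<^sub>2) \<in> A" and Q: "(a\<^sub>3, b\<^sub>3) \<in> A"
  shows "(a\<^sub>2, b\<^sub>2) = (a\<^sub>3, b\<^sub>3) \<and> (s, d) = apex (a\<^sub>2, b\<^sub>2) \<longleftrightarrow>
    (\<forall>t<n. - s $ t + b\<^sub>2 $ t + a\<^sub>3 $ t = 0) \<and> (a\<^sub>3 + b\<^sub>3) + (b\<^sub>2 - a\<^sub>2) = d"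
proof -
  obtain a\<^sub>1 b\<^sub>1 where ab: "(a\<^sub>1, b\<^sub>1) \<in> A" "s = a\<^sub>1 + b\<^sub>1" "d = b\<^sub>1 + b\<^sub>1"
    using x by (auto simp: apex_def)
  have carrier: "a\<^sub>1 \<in> carrier_vec n" "b\<^sub>1 \<in> carrier_vec n" "a\<^sub>2 \<in> carrier_vec n" "b\<^sub>2 \<in> carrier_vec n"
      "a\<^sub>3 \<in> carrier_vec n" "b\<^sub>3 \<in> carrier_vec n"
    using A ab(1) P Q by auto
  show ?thesis
  proof
    assume "(a\<^sub>2, b\<^sub>2) = (a\<^sub>3, b\<^sub>3) \<and> (s, d) = apex (a\<^sub>2, b\<^sub>2)"
    then show "(\<forall>t<n. - s $ t + b\<^sub>2 $ t + a\<^sub>3 $ t = 0) \<and> (a\<^sub>3 + b\<^sub>3) + (b\<^sub>2 - a\<^sub>2) = d"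
      using carrier by (auto simp: apex_def intro!: eq_vecI)
  next
    assume e: "(\<forall>t<n. - s $ t + b\<^sub>2 $ t + a\<^sub>3 $ t = 0) \<and> (a\<^sub>3 + b\<^sub>3) + (b\<^sub>2 - a\<^sub>2) = d"
    note tri = triangle_equations[OF carrier, OF conjunct1[OF e, unfolded ab] conjunct2[OF e, unfolded ab]]
    have "\<not> distinct [(a\<^sub>1, b\<^sub>1), (a\<^sub>2, b\<^sub>2), (a\<^sub>3, b\<^sub>3)]"
    proof
      assume "distinct [(a\<^sub>1, b\<^sub>1), (a\<^sub>2, b\<^sub>2), (a\<^sub>3, b\<^sub>3)]"
      moreover have "a\<^sub>2 - a\<^sub>1 \<in> carrier_vec n" "b\<^sub>2 - b\<^sub>1 \<in> carrier_vec n" using carrier by auto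
      ultimately show False
        using free ab(1) P Q carrier(1,2) tri unfolding triangle_free_def
        by (metis empty_subsetI insert_subset)
    qed
    moreover have "(a\<^sub>2, b\<^sub>2) = (a\<^sub>3, b\<^sub>3)" if "(a\<^sub>1, b\<^sub>1) = (a\<^sub>2, b\<^sub>2)"
      using that tri(3,4) carrier by auto
    moreover have "(a\<^sub>2, b\<^sub>2) = (a\<^sub>3, b\<^sub>3)" if eq: "(a\<^sub>1, b\<^sub>1) = (a\<^sub>3, b\<^sub>3)"
    proof -
      have "a\<^sub>2 $ t = a\<^sub>3 $ t" "b\<^sub>2 $ t = b\<^sub>3 $ t" if "t < n" for t
      proof -
        have "b\<^sub>2 $ t - b\<^sub>1 $ t = a\<^sub>1 $ t - a\<^sub>3 $ t"
          by (subst tri(3)) (use that carrier in simp)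
        moreover have "a\<^sub>2 $ t - a\<^sub>1 $ t = b\<^sub>3 $ t - b\<^sub>1 $ t"
          by (subst tri(4)) (use that carrier in simp)
        ultimately show "a\<^sub>2 $ t = a\<^sub>3 $ t" "b\<^sub>2 $ t = b\<^sub>3 $ t"
          using eq by simp_all
      qed
      then show ?thesis using carrier by (auto simp: carrier_vec_eq_iff)
    qed
    ultimately have "(a\<^sub>2, b\<^sub>2) = (a\<^sub>3, b\<^sub>3)"
      unfolding distinct.simps list.set insert_iff empty_iff by blast
    then have PQ: "a\<^sub>2 = a\<^sub>3" "b\<^sub>2 = b\<^sub>3" by simp_all
    have "s = a\<^sub>3 + b\<^sub>2"
    proof (rule eq_vecI)
      fix t assume "t < dim_vec (a\<^sub>3 + b\<^sub>2)"
      then have t: "t < n" using carrier by simp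
      then have "s $ t + (- s $ t + b\<^sub>2 $ t + a\<^sub>3 $ t) = s $ t" using conjunct1[OF e] by simp
      then show "s $ t = (a\<^sub>3 + b\<^sub>2) $ t" using t carrier by (simp add: add.assoc add.commute)
    qed (use ab(2) carrier in simp)
    moreover have "d = b\<^sub>2 + b\<^sub>2"
      unfolding conjunct2[OF e, symmetric] PQ using carrier by (intro eq_vecI) simp_all
    ultimately show "(a\<^sub>2, b\<^sub>2) = (a\<^sub>3, b\<^sub>3) \<and> (s, d) = apex (a\<^sub>2, b\<^sub>2)"
      using PQ by (simp add: apex_def)
  qed
qed

text \<open>In characteristic two doubling is zero, so \<open>W\<close> is a point while fibres may
  have \<open>q^n\<close> elements. Otherwise doubling is injective, so fibres are at most
  singletons while \<open>W\<close> is the whole space.\<close>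

lemma apex_fibres:
  fixes A :: "('k::{field,finite} vec \<times> 'k vec) set"
  assumes A: "A \<subseteq> carrier_vec n \<times> carrier_vec n"
  obtains F and W :: "'k vec set" where "finite W" "\<And>b. b \<in> carrier_vec n \<Longrightarrow> b + b \<in> W"
    "\<And>x. card {P \<in> A. apex P = x} \<le> F" "F * card W \<le> CARD('k) ^ n"
proof (cases "(1 :: 'k) + 1 = 0")
  case True
  have double: "b + b = 0\<^sub>v n" if "b \<in> carrier_vec n" for b :: "'k vec"
  proof (rule eq_vecI)
    fix t assume "t < dim_vec (0\<^sub>v n :: 'k vec)"
    then have "(b + b) $ t = (1 + 1) * b $ t" using that by (simp add: distrib_right)
    then show "(b + b) $ t = 0\<^sub>v n $ t" using True \<open>t < _\<close> by simp
  qed (use that in simp)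
  have "card {P \<in> A. apex P = x} \<le> CARD('k) ^ n" for x
  proof -
    \<comment> \<open>The sum \<open>a + b\<close> is constant on a fibre, so \<open>a\<close>
      determines \<open>b\<close>.\<close>
    have inj: "inj_on fst {P \<in> A. apex P = x}"
    proof (rule inj_onI)
      fix P Q assume PQ: "P \<in> {P \<in> A. apex P = x}" "Q \<in> {P \<in> A. apex P = x}" "fst P = fst Q"
      obtain a b b' where [simp]: "P = (a, b)" "Q = (a, b')" using PQ(3) by (cases P; cases Q) auto
      have c: "a \<in> carrier_vec n" "b \<in> carrier_vec n" "b' \<in> carrier_vec n" using PQ A by auto
      have "a + b = a + b'" using PQ by (auto simp: apex_def)
      then have "(a + b) $ t = (a + b') $ t" for t by simp
      then have "b $ t = b' $ t" if "t < n" for t using c that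
        by (metis add_left_cancel carrier_vecD index_add_vec(1))
      then show "P = Q" using c by (simp add: carrier_vec_eq_iff)
    qed
    have "card {P \<in> A. apex P = x} \<le> card (carrier_vec n :: 'k vec set)"
      using A by (intro card_inj_on_le[OF inj]) auto
    then show ?thesis by (simp add: card_carrier_vec)
  qed
  then show thesis by (intro that[of "{0\<^sub>v n}" "CARD('k) ^ n"]) (auto simp: double)
next
  case False
  have "card {P \<in> A. apex P = x} \<le> 1" for x
  proof -
    have "P = Q" if PQ: "P \<in> A" "Q \<in> A" "apex P = apex Q" for P Q
    proof -
      obtain a b a' b' where [simp]: "P = (a, b)" "Q = (a', b')" by (cases P; cases Q) auto
      have c: "a \<in> carrier_vec n" "b \<in> carrier_vec n" "a' \<in> carrier_vec n" "b' \<in> carrier_vec n"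
        using PQ A by auto
      have "a $ t = a' $ t \<and> b $ t = b' $ t" if "t < n" for t
      proof -
        have "(a + b) $ t = (a' + b') $ t" "(b + b) $ t = (b' + b') $ t"
          using PQ by (auto simp: apex_def)
        then have e: "a $ t + b $ t = a' $ t + b' $ t" "b $ t + b $ t = b' $ t + b' $ t"
          using c that by auto
        then have "(1 + 1) * b $ t = (1 + 1) * b' $ t" by (simp add: distrib_right)
        then have "b $ t = b' $ t" using False by (simp only: mult_cancel_left) simp
        then show ?thesis using e by simp
      qed
      then show ?thesis using c by (simp add: carrier_vec_eq_iff)
    qed
    moreover have "finite A"
      by (rule finite_subset[OF A]) simp
    ultimately show ?thesis by (auto simp: card_le_Suc0_iff_eq)
  qed
  then show thesis
    by (intro that[of "carrier_vec n" 1]) (auto simp: card_carrier_vec)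
qed

section \<open>Assembling the bound\<close>

lemma triangle_free_card_le:
  fixes A :: "('k::{field,finite} vec \<times> 'k vec) set"
  assumes A: "A \<subseteq> carrier_vec n \<times> carrier_vec n" and free: "triangle_free n A"
  shows "card A \<le> 3 * (CARD('k) ^ n * card (low_exponents (CARD('k) - 1) n))"
proof -
  define I where "I = low_exponents (CARD('k) - 1) n"
  obtain G1 G2 G3 :: "(nat \<Rightarrow> nat) \<Rightarrow> (nat \<Rightarrow> 'k) \<Rightarrow> (nat \<Rightarrow> 'k) \<Rightarrow> 'k" where G:
    "\<And>x y z. of_bool (\<forall>t<n. x t + y t + z t = 0) =
      (\<Sum>i\<in>I. monom_fun n i x * G1 i y z) + (\<Sum>i\<in>I. monom_fun n i y * G2 i x z)
      + (\<Sum>i\<in>I. monom_fun n i z * G3 i x y)"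
    unfolding I_def by (rule sum_zero_slices) blast
  obtain F and W :: "'k vec set" where W: "finite W" "\<And>b. b \<in> carrier_vec n \<Longrightarrow> b + b \<in> W"
    and F: "\<And>x. card {P \<in> A. apex P = x} \<le> F" "F * card W \<le> CARD('k) ^ n"
    by (rule apex_fibres[OF A]) (rule that)
  define V where "V = (carrier_vec n :: 'k vec set)"
  have fin: "finite I" "finite V" "finite A"
    using finite_low_exponents finite_subset[OF A] by (auto simp: I_def V_def)
  have "card A \<le> F * card (W \<times> I) + card (V \<times> I) + card (V \<times> I)"
  \<comment> \<open>The three vectors of the first equation are \<open>- s\<close>, \<open>b\<close>
    and \<open>a'\<close>, one for each tensor variable. Each family carries the matching part of
    the second equation: \<open>d\<close>, \<open>b - a\<close> or \<open>a' + b'\<close>. The part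
    \<open>d\<close> is a double, so it ranges only over \<open>W\<close>.\<close>
  proof (rule slice_rank_bound[where \<pi> = apex
      and ?f1.0 = "\<lambda>(w, i) (s, d). monom_fun n i (\<lambda>t. - s $ t) * of_bool (d = w)"
      and ?g1.0 = "\<lambda>(w, i) (a, b) (a', b'). G1 i (($) b) (($) a') * of_bool ((a' + b') + (b - a) = w)"
      and ?f2.0 = "\<lambda>(w, i) (a, b). monom_fun n i (($) b) * of_bool (b - a = w)"
      and ?g2.0 = "\<lambda>(w, i) (s, d) (a', b'). G2 i (\<lambda>t. - s $ t) (($) a') * of_bool ((a' + b') + w = d)"
      and ?f3.0 = "\<lambda>(w, i) (a', b'). monom_fun n i (($) a') * of_bool (a' + b' = w)"
      and ?g3.0 = "\<lambda>(w, i) (s, d) (a, b). G3 i (\<lambda>t. - s $ t) (($) b) * of_bool (w + (b - a) = d)"])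
    show "finite A" "finite (W \<times> I)" "finite (V \<times> I)" "finite (V \<times> I)" using fin W by auto
    show "card {P \<in> A. apex P = x} \<le> F" for x by (rule F)
    fix x P Q assume *: "x \<in> apex ` A" "P \<in> A" "Q \<in> A"
    obtain s d a b a' b' where xPQ: "x = (s, d)" "P = (a, b)" "Q = (a', b')"
      by (cases x; cases P; cases Q) auto
    have "d \<in> W" using *(1) A W(2) by (auto simp: apex_def xPQ)
    have V: "b - a \<in> V" "a' + b' \<in> V" using *(2,3) A by (auto simp: V_def xPQ)
    have "(of_bool (P = Q \<and> x = apex P) :: 'k) =
        of_bool (\<forall>t<n. - s $ t + b $ t + a' $ t = 0) * of_bool ((a' + b') + (b - a) = d)"
      using triangle_free_test[OF A free, of s d a b a' b'] * by (simp add: xPQ flip: of_bool_conj)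
    also have "\<dots> =
      (\<Sum>(w, i)\<in>W \<times> I. (monom_fun n i (\<lambda>t. - s $ t) * of_bool (d = w)) *
        (G1 i (($) b) (($) a') * of_bool ((a' + b') + (b - a) = w))) +
      (\<Sum>(w, i)\<in>V \<times> I. (monom_fun n i (($) b) * of_bool (b - a = w)) *
        (G2 i (\<lambda>t. - s $ t) (($) a') * of_bool ((a' + b') + w = d))) +
      (\<Sum>(w, i)\<in>V \<times> I. (monom_fun n i (($) a') * of_bool (a' + b' = w)) *
        (G3 i (\<lambda>t. - s $ t) (($) b) * of_bool (w + (b - a) = d)))"
      unfolding G distrib_right
      by (intro arg_cong2[of _ _ _ _ "(+)"]
          slice_product[OF fin(1) W(1) \<open>d \<in> W\<close>, where T = "\<lambda>w. (a' + b') + (b - a) = w"]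
          slice_product[OF fin(1,2) V(1), where T = "\<lambda>w. (a' + b') + w = d"]
          slice_product[OF fin(1,2) V(2), where T = "\<lambda>w. w + (b - a) = d"])
    finally show "of_bool (P = Q \<and> x = apex P) =
      (\<Sum>j\<in>W \<times> I. (\<lambda>(w, i) (s, d). monom_fun n i (\<lambda>t. - s $ t) * of_bool (d = w)) j x *
        (\<lambda>(w, i) (a, b) (a', b'). G1 i (($) b) (($) a') * of_bool ((a' + b') + (b - a) = w)) j P Q) +
      (\<Sum>j\<in>V \<times> I. (\<lambda>(w, i) (a, b). monom_fun n i (($) b) * of_bool (b - a = w)) j P *
        (\<lambda>(w, i) (s, d) (a', b'). G2 i (\<lambda>t. - s $ t) (($) a') * of_bool ((a' + b') + w = d)) j x Q) +
      (\<Sum>j\<in>V \<times> I. (\<lambda>(w, i) (a', b'). monom_fun n i (($) a') * of_bool (a' + b' = w)) j Q *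
        (\<lambda>(w, i) (s, d) (a, b). G3 i (\<lambda>t. - s $ t) (($) b) * of_bool (w + (b - a) = d)) j x P)"
      by (simp only: xPQ case_prod_unfold prod.sel)
  qed
  also have "\<dots> = F * card W * card I + 2 * (CARD('k) ^ n * card I)"
    by (simp add: card_cartesian_product V_def card_carrier_vec)
  also have "\<dots> \<le> CARD('k) ^ n * card I + 2 * (CARD('k) ^ n * card I)"
    by (intro add_mono mult_right_mono F order_refl) simp
  finally show ?thesis by (simp add: I_def)
qed

theorem theorem3:
  fixes q :: nat
  assumes "primepow q"
    and "card (UNIV :: 'k::{field,finite} set) = q"
  shows "\<exists>c::real. 0 < c \<and> c < real q \<and>
    (\<forall>n::nat. n > 0 \<longrightarrow>
      (\<forall>A :: ('k vec \<times> 'k vec) set.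
        A \<subseteq> carrier_vec n \<times> carrier_vec n \<longrightarrow>
        \<not> (\<exists>a\<in>carrier_vec n. \<exists>b\<in>carrier_vec n. \<exists>u\<in>carrier_vec n. \<exists>v\<in>carrier_vec n.
              distinct [(a, b), (a + u, b + v), (a - v, b + u)] \<and>
              {(a, b), (a + u, b + v), (a - v, b + u)} \<subseteq> A) \<longrightarrow>
        real (card A) \<le> 3 * c ^ (2 * n)))"
proof -
  have q: "q > 1" using assms(1) by (rule primepow_gt_Suc_0[unfolded One_nat_def[symmetric]])
  obtain z :: real where z: "0 < z" "z < 1" and lt: "(\<Sum>i\<le>q - 1. z ^ (3 * i)) / z ^ (q - 1) < Suc (q - 1)"
    using exists_growth_rate[of "q - 1"] q by auto
  define \<gamma> where "\<gamma> = (\<Sum>i\<le>q - 1. z ^ (3 * i)) / z ^ (q - 1)"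
  have \<gamma>: "0 < \<gamma>" "\<gamma> < real q"
    using z lt q by (auto simp: \<gamma>_def intro!: divide_pos_pos sum_pos)
  \<comment> \<open>The bound is \<open>3 * (q * \<gamma>) ^ n\<close>, so \<open>c\<close> is the
    geometric mean of \<open>q\<close> and \<open>\<gamma>\<close>; it lies below \<open>q\<close>
    because \<open>\<gamma>\<close> does.\<close>
  define c where "c = sqrt (real q * \<gamma>)"
  have "0 < c" using \<gamma> q by (simp add: c_def)
  moreover have "c < real q"
    unfolding c_def using \<gamma> q by (intro real_less_lsqrt) (auto simp: power2_eq_square)
  moreover have "real (card A) \<le> 3 * c ^ (2 * n)"
    if "A \<subseteq> carrier_vec n \<times> carrier_vec n" "triangle_free n A" for n and A :: "('k vec \<times> 'k vec) set"
  proof -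
    have "real (card A) \<le> real (3 * (q ^ n * card (low_exponents (q - 1) n)))"
      using triangle_free_card_le[OF that] unfolding assms(2) of_nat_le_iff .
    also have "\<dots> \<le> 3 * (real q ^ n * \<gamma> ^ n)"
      using card_low_exponents_le[of z "q - 1" n] z unfolding \<gamma>_def[symmetric] by (simp add: mult_left_mono)
    also have "real q ^ n * \<gamma> ^ n = c ^ (2 * n)"
      using \<gamma> by (simp add: c_def power_mult power_mult_distrib)
    finally show ?thesis .
  qed
  ultimately show ?thesis
    unfolding triangle_free_def by (intro exI[of _ c] conjI allI impI)
qed

end
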